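(* Let $\mathbb M$ be a finitely presentable $2$-parameter persistence module, and let $L=(l_i)_{1\le i\le N}$ be an ordered set of diagonal lines of $\mathbb R^2$ with increasing basepoints. For each index $1\le i\le N-1$, let $\sigma_i$ be an arbitrary compatible matching function between $\mathcal B(\mathbb M|_{l_i})$ and $\mathcal B(\mathbb M|_{l_{i+1}})$. Then the matching function $\sigma=(\sigma_i)_i$ is a compatible matching function on $L$, i.e., any two bars (along any two lines of $L$) that are matched by composing successive $\sigma_i$'s are compatible.
   Context: Fix a field $k$. $\le_2$ is the coordinatewise order on $\mathbb R^2$; $x<_2y$ means $x_1<y_1$ and $x_2<y_2$. A $2$-parameter persistence module is a functor from $(\mathbb R^2,\le_2)$ to $k$-vector spaces; for an up-set $\{y\ge_2 x\}$, $k^{\{y\ge_2 x\}}$ denotes the module equal to $k$ on this set, $0$ elsewhere, with identity maps inside the set. The module is finitely presentable if it is the cokernel of a morphism between finite direct sums of modules $k^{\{y\ge_2 x\}}$. A diagonal line is a line with direction $(1,1)$; its basepoint is its intersection $(x,0)$ with the horizontal axis, and basepoints are ordered by $x$. For a diagonal line $l$, $\mathbb M|_l$ is a one-parameter module and its barcode $\mathcal B(\mathbb M|_l)$ is the multiset of bars $[b,d)$ of its interval decomposition, viewed as segments of $l\subset\mathbb R^2$ (endpoints may be $\pm\boldsymbol\infty$). A matching function between $l$ and $l'$ is a map $\sigma:\mathcal B(\mathbb M|_l)\to\mathcal B(\mathbb M|_{l'})\cup\{\varnothing\}$ whose restriction to $\sigma^{-1}(\mathcal B(\mathbb M|_{l'}))$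 is injective. Two bars $[b_1,d_1)$, $[b_2,d_2)$ along two diagonal lines are compatible if neither $b_1<_2b_2$ nor $b_2<_2b_1$, and neither $d_1<_2d_2$ nor $d_2<_2d_1$. A compatible matching function is a matching function that only pairs bars that are compatible. *)

theory Defs
  imports "HOL-Algebra.Module" "HOL-Algebra.AbelCoset" "HOL-Library.Product_Order"
    "HOL-Library.Extended_Real" "HOL-Library.Multiset"
begin

section \<open>Persistence modules\<close>

text \<open>
  A persistence module over a poset assigns to every index a \<open>K\<close>-vector space and to every
  comparable pair of indices a linear map. Only the values of the transition maps on the
  carriers are meaningful. On \<^typ>\<open>real \<times> real\<close> the order is the coordinatewise one.
\<close>

record ('p, 'k, 'v) pmodule =
  pspace :: "'p \<Rightarrow> ('k, 'v) module"
  transition :: "'p \<Rightarrow> 'p \<Rightarrow> 'v \<Rightarrow> 'v"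

definition linear_maps ::
  "('k, 'm) ring_scheme \<Rightarrow> ('k, 'v, 'a) module_scheme \<Rightarrow> ('k, 'w, 'b) module_scheme \<Rightarrow> ('v \<Rightarrow> 'w) set"
  where "linear_maps K V W =
    {h \<in> carrier V \<rightarrow> carrier W.
       (\<forall>u \<in> carrier V. \<forall>v \<in> carrier V. h (u \<oplus>\<^bsub>V\<^esub> v) = h u \<oplus>\<^bsub>W\<^esub> h v) \<and>
       (\<forall>r \<in> carrier K. \<forall>v \<in> carrier V. h (r \<odot>\<^bsub>V\<^esub> v) = r \<odot>\<^bsub>W\<^esub> h v)}"

locale persistence_module = K: field K
  for K :: "('k, 'm) ring_scheme" (structure) and M :: "('p::order, 'k, 'v) pmodule" +
  assumes module_space: "\<And>x. Module.module K (pspace M x)"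
    and transition_linear: "\<And>x y. x \<le> y \<Longrightarrow> transition M x y \<in> linear_maps K (pspace M x) (pspace M y)"
    and transition_refl: "\<And>x v. v \<in> carrier (pspace M x) \<Longrightarrow> transition M x x v = v"
    and transition_comp: "\<And>x y z v. x \<le> y \<Longrightarrow> y \<le> z \<Longrightarrow> v \<in> carrier (pspace M x) \<Longrightarrow>
      transition M y z (transition M x y v) = transition M x z v"

definition pmorphism ::
  "('k, 'm) ring_scheme \<Rightarrow> ('p::order, 'k, 'v) pmodule \<Rightarrow> ('p, 'k, 'w) pmodule \<Rightarrow>
   ('p \<Rightarrow> 'v \<Rightarrow> 'w) \<Rightarrow> bool"
  where "pmorphism K M N f \<longleftrightarrow>
    (\<forall>x. f x \<in> linear_maps K (pspace M x) (pspace N x)) \<and>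
    (\<forall>x y. x \<le> y \<longrightarrow> (\<forall>v \<in> carrier (pspace M x). f y (transition M x y v) = transition N x y (f x v)))"

definition pmodule_iso ::
  "('k, 'm) ring_scheme \<Rightarrow> ('p::order, 'k, 'v) pmodule \<Rightarrow> ('p, 'k, 'w) pmodule \<Rightarrow> bool"
  where "pmodule_iso K M N \<longleftrightarrow>
    (\<exists>f. pmorphism K M N f \<and> (\<forall>x. bij_betw (f x) (carrier (pspace M x)) (carrier (pspace N x))))"

text \<open>
  The module \<open>k\<^sup>S\<close>: it is \<open>k\<close> on \<open>S\<close> with identity maps inside \<open>S\<close>, and \<open>0\<close> elsewhere.
  It is a persistence module when \<open>S\<close> is order-convex. The fields \<^const>\<open>monoid.mult\<close> and
  \<^const>\<open>one\<close>, which the record type \<^typ>\<open>('k, 'v) module\<close> inherits from rings, play no role in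
  \<^locale>\<open>Module.module\<close>; here and below they are left undefined.
\<close>

definition indicator_module ::
  "('k, 'm) ring_scheme \<Rightarrow> 'p set \<Rightarrow> ('p::order, 'k, 'k) pmodule"
  where "indicator_module K S = \<lparr>
    pspace = (\<lambda>x. \<lparr>carrier = (if x \<in> S then carrier K else {\<zero>\<^bsub>K\<^esub>}),
                  monoid.mult = undefined, one = undefined,
                  zero = \<zero>\<^bsub>K\<^esub>, add = add K, smult = monoid.mult K\<rparr>),
    transition = (\<lambda>x y v. if x \<in> S \<and> y \<in> S then v else \<zero>\<^bsub>K\<^esub>)\<rparr>"

text \<open>The index set \<open>I\<close> is meant to be finite, so that the product is the direct sum.\<close>

definition finite_direct_sum ::
  "'i set \<Rightarrow> ('i \<Rightarrow> ('p::order, 'k, 'v) pmodule) \<Rightarrow> ('p, 'k, 'i \<Rightarrow> 'v) pmodule"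
  where "finite_direct_sum I M = \<lparr>
    pspace = (\<lambda>x. \<lparr>carrier = (\<Pi>\<^sub>E i\<in>I. carrier (pspace (M i) x)),
                  monoid.mult = undefined, one = undefined,
                  zero = (\<lambda>i\<in>I. \<zero>\<^bsub>pspace (M i) x\<^esub>),
                  add = (\<lambda>u v. \<lambda>i\<in>I. u i \<oplus>\<^bsub>pspace (M i) x\<^esub> v i),
                  smult = (\<lambda>r v. \<lambda>i\<in>I. r \<odot>\<^bsub>pspace (M i) x\<^esub> v i)\<rparr>),
    transition = (\<lambda>x y v. \<lambda>i\<in>I. transition (M i) x y (v i))\<rparr>"

text \<open>
  The cokernel of \<open>f : M \<rightarrow> N\<close> is the pointwise quotient of \<open>N\<close> by the image of \<open>f\<close>; its
  elements are cosets. Operations on a coset are taken as unions over its representatives.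
\<close>

definition cokernel ::
  "('p::order, 'k, 'v) pmodule \<Rightarrow> ('p, 'k, 'w) pmodule \<Rightarrow> ('p \<Rightarrow> 'v \<Rightarrow> 'w) \<Rightarrow>
   ('p, 'k, 'w set) pmodule"
  where "cokernel M N f = (let im = (\<lambda>x. f x ` carrier (pspace M x)) in \<lparr>
    pspace = (\<lambda>x. \<lparr>carrier = a_rcosets\<^bsub>pspace N x\<^esub> im x,
                  monoid.mult = undefined, one = undefined,
                  zero = im x,
                  add = set_add (pspace N x),
                  smult = (\<lambda>r C. \<Union>v\<in>C. im x +>\<^bsub>pspace N x\<^esub> (r \<odot>\<^bsub>pspace N x\<^esub> v))\<rparr>),
    transition = (\<lambda>x y C. \<Union>v\<in>C. im y +>\<^bsub>pspace N y\<^esub> transition N x y v)\<rparr>)"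

definition free_pmodule ::
  "('k, 'm) ring_scheme \<Rightarrow> 'p::order list \<Rightarrow> ('p, 'k, nat \<Rightarrow> 'k) pmodule"
  where "free_pmodule K as =
    finite_direct_sum {..<length as} (\<lambda>j. indicator_module K {y. as ! j \<le> y})"

definition finitely_presentable ::
  "('k, 'm) ring_scheme \<Rightarrow> ('p::order, 'k, 'v) pmodule \<Rightarrow> bool"
  where "finitely_presentable K M \<longleftrightarrow>
    (\<exists>as bs f. pmorphism K (free_pmodule K as) (free_pmodule K bs) f \<and>
       pmodule_iso K M (cokernel (free_pmodule K as) (free_pmodule K bs) f))"


section \<open>Barcodes along diagonal lines\<close>

definition diagonal_line :: "(real \<times> real) set \<Rightarrow> bool"
  where "diagonal_line l \<longleftrightarrow> (\<exists>a b. l = range (\<lambda>t. (a + t, b + t)))"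

definition basepoint :: "(real \<times> real) set \<Rightarrow> real"
  where "basepoint l = (THE x. (x, 0) \<in> l)"

text \<open>
  A diagonal line \<open>l\<close> is parametrised by \<open>t \<mapsto> (basepoint l + t, t)\<close>, an order isomorphism
  from the reals onto \<open>l\<close>. So \<open>M|\<^sub>l\<close> becomes a persistence module over the reals.
\<close>

definition restrict_line ::
  "(real \<times> real, 'k, 'v) pmodule \<Rightarrow> (real \<times> real) set \<Rightarrow> (real, 'k, 'v) pmodule"
  where "restrict_line M l = \<lparr>
    pspace = (\<lambda>t. pspace M (basepoint l + t, t)),
    transition = (\<lambda>s t. transition M (basepoint l + s, s) (basepoint l + t, t))\<rparr>"

text \<open>
  A pair \<open>(b, d)\<close> with \<open>b < d\<close> encodes the interval \<open>[b, d)\<close>. The list \<open>cs\<close> below enumerates the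
  intervals of a decomposition. It is determined up to order by the module, so the barcode
  is the multiset \<open>mset cs\<close>.
\<close>

definition interval_module ::
  "('k, 'm) ring_scheme \<Rightarrow> ereal \<times> ereal \<Rightarrow> (real, 'k, 'k) pmodule"
  where "interval_module K c = indicator_module K {t. fst c \<le> ereal t \<and> ereal t < snd c}"

definition has_barcode ::
  "('k, 'm) ring_scheme \<Rightarrow> (real, 'k, 'v) pmodule \<Rightarrow> (ereal \<times> ereal) multiset \<Rightarrow> bool"
  where "has_barcode K N B \<longleftrightarrow>
    (\<exists>cs. B = mset cs \<and> (\<forall>c \<in> set cs. fst c < snd c) \<and>
       pmodule_iso K N (finite_direct_sum {..<length cs} (\<lambda>j. interval_module K (cs ! j))))"

text \<open>
  A bar in the plane is the pair of its endpoints \<open>b\<close> and \<open>d\<close>. For \<open>t = \<plusminus>\<infinity>\<close> the embedding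
  of the line gives the points \<open>(\<infinity>, \<infinity>)\<close> and \<open>(-\<infinity>, -\<infinity>)\<close>, whatever the line.
\<close>

type_synonym bar = "(ereal \<times> ereal) \<times> (ereal \<times> ereal)"

definition line_point :: "(real \<times> real) set \<Rightarrow> ereal \<Rightarrow> ereal \<times> ereal"
  where "line_point l t = (ereal (basepoint l) + t, t)"

definition has_line_barcode ::
  "('k, 'm) ring_scheme \<Rightarrow> (real \<times> real, 'k, 'v) pmodule \<Rightarrow> (real \<times> real) set \<Rightarrow> bar multiset \<Rightarrow> bool"
  where "has_line_barcode K M l B \<longleftrightarrow>
    (\<exists>B\<^sub>0. has_barcode K (restrict_line M l) B\<^sub>0 \<and>
       B = image_mset (\<lambda>(b, d). (line_point l b, line_point l d)) B\<^sub>0)"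


section \<open>Matching functions\<close>

definition strictly_below :: "ereal \<times> ereal \<Rightarrow> ereal \<times> ereal \<Rightarrow> bool"  (infix \<open><\<^sub>2\<close> 50)
  where "x <\<^sub>2 y \<longleftrightarrow> fst x < fst y \<and> snd x < snd y"

definition compatible :: "bar \<Rightarrow> bar \<Rightarrow> bool"
  where "compatible p q \<longleftrightarrow>
    \<not> fst p <\<^sub>2 fst q \<and> \<not> fst q <\<^sub>2 fst p \<and> \<not> snd p <\<^sub>2 snd q \<and> \<not> snd q <\<^sub>2 snd p"

text \<open>
  A matching function acts on the elements of a multiset counted with multiplicity: the pair
  \<open>(p, n)\<close> is the \<open>n\<close>-th copy of \<open>p\<close>, and \<^const>\<open>None\<close> is the value for unmatched elements.
\<close>

definition copies :: "'b multiset \<Rightarrow> ('b \<times> nat) set"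
  where "copies B = {(p, n). n < count B p}"

definition matching_function ::
  "'b multiset \<Rightarrow> 'b multiset \<Rightarrow> ('b \<times> nat \<Rightarrow> ('b \<times> nat) option) \<Rightarrow> bool"
  where "matching_function B B' \<sigma> \<longleftrightarrow>
    \<sigma> \<in> copies B \<rightarrow> insert None (Some ` copies B') \<and>
    inj_on \<sigma> {p \<in> copies B. \<sigma> p \<in> Some ` copies B'}"

definition compatible_matching_function ::
  "bar multiset \<Rightarrow> bar multiset \<Rightarrow> (bar \<times> nat \<Rightarrow> (bar \<times> nat) option) \<Rightarrow> bool"
  where "compatible_matching_function B B' \<sigma> \<longleftrightarrow>
    matching_function B B' \<sigma> \<and>
    (\<forall>p \<in> copies B. \<forall>q \<in> copies B'. \<sigma> p = Some q \<longrightarrow> compatible (fst p) (fst q))"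

text \<open>\<open>compose_matching \<sigma> i n\<close> is the composite of \<open>\<sigma>\<^sub>i, \<dots>, \<sigma>\<^sub>i\<^sub>+\<^sub>n\<^sub>-\<^sub>1\<close>, from line \<open>i\<close> to line \<open>i + n\<close>.\<close>

primrec compose_matching ::
  "(nat \<Rightarrow> 'a \<Rightarrow> 'a option) \<Rightarrow> nat \<Rightarrow> nat \<Rightarrow> 'a \<Rightarrow> 'a option"
  where
    "compose_matching \<sigma> i 0 p = Some p"
  | "compose_matching \<sigma> i (Suc n) p = Option.bind (compose_matching \<sigma> i n p) (\<sigma> (i + n))"

definition compatible_matching_on_lines ::
  "nat \<Rightarrow> (nat \<Rightarrow> bar multiset) \<Rightarrow> (nat \<Rightarrow> bar \<times> nat \<Rightarrow> (bar \<times> nat) option) \<Rightarrow> bool"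
  where "compatible_matching_on_lines N B \<sigma> \<longleftrightarrow>
    (\<forall>i j. 1 \<le> i \<and> i < j \<and> j \<le> N \<longrightarrow>
       compatible_matching_function (B i) (B j) (compose_matching \<sigma> i (j - i)))"

end

theory Submission
  imports Defs
begin

text \<open>
  Along lines with increasing basepoints, two points are incomparable for \<open><\<^sub>2\<close> exactly when the
  one on the right-hand line lies weakly to the lower right of the other. Unlike
  incomparability itself, this relation is transitive.
\<close>

definition lower_right :: "ereal \<times> ereal \<Rightarrow> ereal \<times> ereal \<Rightarrow> bool"
  where "lower_right x y \<longleftrightarrow> fst x \<le> fst y \<and> snd y \<le> snd x"

lemma lower_right_trans: "lower_right x y \<Longrightarrow> lower_right y z \<Longrightarrow> lower_right x z"
  by (auto simp: lower_right_def)

lemma lower_right_refl: "lower_right x x"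
  by (simp add: lower_right_def)

lemma lower_right_incomparable:
  "lower_right x y \<Longrightarrow> \<not> x <\<^sub>2 y \<and> \<not> y <\<^sub>2 x"
  by (auto simp: lower_right_def strictly_below_def)

text \<open>If \<open>s < t\<close>, the larger basepoint makes the first coordinate grow as well,
  so the points would be strictly comparable; hence \<open>t \<le> s\<close>. If the first
  coordinate on \<open>l\<close> exceeded the one on \<open>l'\<close>, then \<open>t < s\<close>
  would follow, again a strict comparison. A point with infinite parameter is strictly comparable to
  every line point except itself, so then both points coincide.\<close>

lemma incomparable_line_points_lower_right:
  assumes "basepoint l < basepoint l'"
    and "\<not> line_point l s <\<^sub>2 line_point l' t" "\<not> line_point l' t <\<^sub>2 line_point l s"
  shows "lower_right (line_point l s) (line_point l' t)"
  using assms
  by (cases s; cases t) (auto simp: lower_right_def strictly_below_def line_point_def)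

text \<open>Supplies the parameters of both endpoints on the common line, which the comparison of
  line points takes as input.\<close>

lemma line_barcode_endpoints:
  assumes "has_line_barcode K M l B" "(p, n) \<in> copies B"
  obtains b d where "p = (line_point l b, line_point l d)"
proof -
  have "p \<in># B"
    using assms(2) by (auto simp: copies_def intro: count_inI)
  with assms(1) that show thesis
    by (auto simp: has_line_barcode_def)
qed

lemma matching_function_mem:
  assumes "matching_function B B' \<sigma>" "p \<in> copies B" "\<sigma> p = Some q"
  shows "q \<in> copies B'"
  using assms by (force simp: matching_function_def)

lemma matching_function_inj:
  assumes "matching_function B B' \<sigma>" "p \<in> copies B" "p' \<in> copies B" "\<sigma> p = Some q" "\<sigma> p' = Some q"
  shows "p = p'"
proof -
  have "q \<in> copies B'"
    using assms(1,2,4) by (rule matching_function_mem)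
  with assms have "p \<in> {p \<in> copies B. \<sigma> p \<in> Some ` copies B'}"
      "p' \<in> {p \<in> copies B. \<sigma> p \<in> Some ` copies B'}"
    by simp_all
  then show ?thesis
    using assms(1,4,5) inj_onD[of \<sigma> "{p \<in> copies B. \<sigma> p \<in> Some ` copies B'}" p p']
    by (simp add: matching_function_def)
qed

text \<open>Elements sent to \<open>None\<close> are exempt from injectivity, so both conditions can
  be checked on matched elements alone.\<close>

lemma matching_functionI:
  assumes "\<And>p q. p \<in> copies B \<Longrightarrow> \<sigma> p = Some q \<Longrightarrow> q \<in> copies B'"
    and "\<And>p p' q. p \<in> copies B \<Longrightarrow> p' \<in> copies B \<Longrightarrow> \<sigma> p = Some q \<Longrightarrow> \<sigma> p' = Some q \<Longrightarrow> p = p'"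
  shows "matching_function B B' \<sigma>"
  unfolding matching_function_def
proof
  show "\<sigma> \<in> copies B \<rightarrow> insert None (Some ` copies B')"
  proof
    fix p assume "p \<in> copies B"
    then show "\<sigma> p \<in> insert None (Some ` copies B')"
      using assms(1)[of p] by (cases "\<sigma> p") simp_all
  qed
  show "inj_on \<sigma> {p \<in> copies B. \<sigma> p \<in> Some ` copies B'}"
  proof (rule inj_onI)
    fix p p'
    assume p: "p \<in> {p \<in> copies B. \<sigma> p \<in> Some ` copies B'}"
      and p': "p' \<in> {p \<in> copies B. \<sigma> p \<in> Some ` copies B'}" and eq: "\<sigma> p = \<sigma> p'"
    from p obtain q where q: "\<sigma> p = Some q"
      by blast
    with eq have "\<sigma> p' = Some q"
      by (rule subst)
    with p p' q assms(2)[of p p' q] show "p = p'"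
      by blast
  qed
qed

text \<open>Partial injections compose: a common final value forces equal intermediate values, and
  these force equal starting values.\<close>

lemma matching_function_comp:
  assumes "matching_function B B' \<sigma>" "matching_function B' B'' \<tau>"
  shows "matching_function B B'' (\<lambda>p. Option.bind (\<sigma> p) \<tau>)"
proof (rule matching_functionI)
  show "q \<in> copies B''" if "p \<in> copies B" "Option.bind (\<sigma> p) \<tau> = Some q" for p q
    using that assms by (auto simp: bind_eq_Some_conv dest: matching_function_mem)
  show "p = p'" if "p \<in> copies B" "p' \<in> copies B"
    "Option.bind (\<sigma> p) \<tau> = Some q" "Option.bind (\<sigma> p') \<tau> = Some q" for p p' q
  proof -
    from that(3,4) obtain r r' where r: "\<sigma> p = Some r" "\<tau> r = Some q"
      and r': "\<sigma> p' = Some r'" "\<tau> r' = Some q"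
      by (auto simp: bind_eq_Some_conv)
    \<comment> \<open>Injectivity of \<open>\<tau>\<close> is available only on
      \<open>copies B'\<close>, so the intermediate values must first be placed there.\<close>
    have "r \<in> copies B'" "r' \<in> copies B'"
      using assms(1) that(1,2) r(1) r'(1) by (auto dest: matching_function_mem)
    then have "r = r'"
      using r(2) r'(2) by (rule matching_function_inj[OF assms(2)])
    with r'(1) have "\<sigma> p' = Some r"
      by simp
    with assms(1) that(1,2) r(1) show ?thesis
      by (rule matching_function_inj)
  qed
qed

lemma matching_function_Some: "matching_function B B Some"
  by (rule matching_functionI) simp_all

theorem proposition17:
  fixes K :: "('k, 'm) ring_scheme"
    and M :: "(real \<times> real, 'k, 'v) pmodule"
    and N :: nat
    and l :: "nat \<Rightarrow> (real \<times> real) set"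
    and B :: "nat \<Rightarrow> bar multiset"
    and \<sigma> :: "nat \<Rightarrow> bar \<times> nat \<Rightarrow> (bar \<times> nat) option"
  assumes "persistence_module K M"
    and "finitely_presentable K M"
    and "\<And>i. 1 \<le> i \<Longrightarrow> i \<le> N \<Longrightarrow> diagonal_line (l i)"
    and "\<And>i j. 1 \<le> i \<Longrightarrow> i < j \<Longrightarrow> j \<le> N \<Longrightarrow> basepoint (l i) < basepoint (l j)"
    and "\<And>i. 1 \<le> i \<Longrightarrow> i \<le> N \<Longrightarrow> has_line_barcode K M (l i) (B i)"
    and "\<And>i. 1 \<le> i \<Longrightarrow> i < N \<Longrightarrow> compatible_matching_function (B i) (B (Suc i)) (\<sigma> i)"
  shows "compatible_matching_on_lines N B \<sigma>"
proof -
  note basepoints = assms(4) and barcodes = assms(5) and matchings = assms(6)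
  \<comment> \<open>A directed form of \<open>compatible\<close>: both endpoints move weakly right
    and down. Being transitive, it survives composition.\<close>
  define R :: "bar \<Rightarrow> bar \<Rightarrow> bool"
    where "R p q \<longleftrightarrow> lower_right (fst p) (fst q) \<and> lower_right (snd p) (snd q)" for p q
  have step: "R (fst p) (fst q)"
    if i: "1 \<le> i" "i < N" and p: "p \<in> copies (B i)" and pq: "\<sigma> i p = Some q" for i p q
  proof -
    have q: "q \<in> copies (B (Suc i))"
      using matchings[OF i, unfolded compatible_matching_function_def, THEN conjunct1] p pq
      by (rule matching_function_mem)
    then have "compatible (fst p) (fst q)"
      using matchings[OF i] p pq unfolding compatible_matching_function_def by blast
    \<comment> \<open>Once the endpoints are written as points of two consecutive lines, the order
      of the basepoints decides the direction of each incomparability.\<close>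
    moreover obtain b d where "fst p = (line_point (l i) b, line_point (l i) d)"
      using line_barcode_endpoints[OF barcodes, of i "fst p" "snd p"] i p by auto
    moreover obtain b' d' where "fst q = (line_point (l (Suc i)) b', line_point (l (Suc i)) d')"
      using line_barcode_endpoints[OF barcodes, of "Suc i" "fst q" "snd q"] i q by auto
    moreover have "basepoint (l i) < basepoint (l (Suc i))"
      using basepoints i by simp
    ultimately show ?thesis
      by (simp add: R_def compatible_def incomparable_line_points_lower_right)
  qed
  \<comment> \<open>Both claims share one induction: \<open>step\<close> applies to an intermediate
    bar only once that bar is known to be a copy in \<open>B (i + n)\<close>.\<close>
  have chain: "matching_function (B i) (B (i + n)) (compose_matching \<sigma> i n) \<and>
      (\<forall>p \<in> copies (B i). \<forall>q. compose_matching \<sigma> i n p = Some q \<longrightarrow> R (fst p) (fst q))"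
    if "1 \<le> i" "i + n \<le> N" for i n
    using that
  proof (induction n)
    case 0
    have "compose_matching \<sigma> i 0 = Some"
      by (simp add: fun_eq_iff)
    then show ?case
      by (simp add: matching_function_Some R_def lower_right_refl)
  next
    case (Suc n)
    have IH: "matching_function (B i) (B (i + n)) (compose_matching \<sigma> i n)"
      "\<And>p q. p \<in> copies (B i) \<Longrightarrow> compose_matching \<sigma> i n p = Some q \<Longrightarrow> R (fst p) (fst q)"
      using Suc by auto
    have comp: "compose_matching \<sigma> i (Suc n) =
        (\<lambda>p. Option.bind (compose_matching \<sigma> i n p) (\<sigma> (i + n)))"
      by (simp add: fun_eq_iff)
    \<comment> \<open>The bound \<open>i + Suc n \<le> N\<close> gives \<open>i + n < N\<close>, so
      \<open>\<sigma> (i + n)\<close> is one of the given matchings.\<close>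
    have "matching_function (B (i + n)) (B (Suc (i + n))) (\<sigma> (i + n))"
      using matchings[of "i + n"] Suc.prems by (simp add: compatible_matching_function_def)
    with IH(1) have "matching_function (B i) (B (i + Suc n)) (compose_matching \<sigma> i (Suc n))"
      unfolding comp add_Suc_right by (rule matching_function_comp)
    moreover have "R (fst p) (fst q)"
      if p: "p \<in> copies (B i)" and "compose_matching \<sigma> i (Suc n) p = Some q" for p q
    proof -
      obtain r where r: "compose_matching \<sigma> i n p = Some r" "\<sigma> (i + n) r = Some q"
        using \<open>compose_matching \<sigma> i (Suc n) p = Some q\<close> by (auto simp: bind_eq_Some_conv)
      have "R (fst p) (fst r)"
        using p r(1) by (rule IH(2))
      moreover have "R (fst r) (fst q)"
        using step[of "i + n" r q] matching_function_mem[OF IH(1) p r(1)] r(2) Suc.prems by simp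
      ultimately show ?thesis
        unfolding R_def by (blast intro: lower_right_trans)
    qed
    ultimately show ?case
      by blast
  qed
  \<comment> \<open>For each endpoint, a strict increase contradicts the weak descent of the second
    coordinate, and a strict decrease contradicts the weak growth of the first.\<close>
  have compat: "compatible p q" if "R p q" for p q
    using that by (simp add: R_def compatible_def lower_right_incomparable)
  show ?thesis
    unfolding compatible_matching_on_lines_def compatible_matching_function_def
  proof (intro allI impI conjI ballI)
    fix i j assume "1 \<le> i \<and> i < j \<and> j \<le> N"
    \<comment> \<open>The chain has length \<open>j - i\<close>; as \<open>i < j\<close>, the
      truncated subtraction is exact.\<close>
    then have "1 \<le> i" "i + (j - i) \<le> N" and j: "i + (j - i) = j"
      by simp_all
    note * = chain[OF this(1,2), unfolded j]
    show "matching_function (B i) (B j) (compose_matching \<sigma> i (j - i))"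
      using * by (rule conjunct1)
    show "compatible (fst p) (fst q)"
      if "p \<in> copies (B i)" "compose_matching \<sigma> i (j - i) p = Some q" for p q
      by (rule compat, rule *[THEN conjunct2, rule_format, OF that])
  qed
qed

end
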